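(* For every $\epsilon>0$ it holds that $M(\epsilon) \ge \operatorname{twr}(\lfloor 1/(16\epsilon) \rfloor)$. Equivalently: for every $\epsilon>0$ there exist a positive integer $n$ and a function $f:\mathbb{Z}_2^n\to[0,1]$ such that every $\epsilon$-regular subspace $H\le \mathbb{Z}_2^n$ for $f$ has index $|\mathbb{Z}_2^n/H| \ge \operatorname{twr}(\lfloor 1/(16\epsilon) \rfloor)$.
   Context: For an affine subspace $A$ of $\mathbb{Z}_2^n$ (a translate $A=H+g$ of a linear subspace $H\le\mathbb{Z}_2^n$) and a function $f:A\to[0,1]$, the Fourier coefficient of $f$ at $\eta\in\mathbb{Z}_2^n$ is $\widehat{f}(\eta)=\frac{1}{|A|}\sum_{x\in A} f(x)(-1)^{\langle x,\eta\rangle}$. Such $f$ is called $\epsilon$-regular if $\max_{\eta\notin H^\perp}|\widehat{f}(\eta)|\le\epsilon$. For $f:\mathbb{Z}_2^n\to[0,1]$ and an affine subspace $A$, $f|_A$ denotes the restriction of $f$ to $A$. The index of a subspace $H\le\mathbb{Z}_2^n$ is $|\mathbb{Z}_2^n/H|=2^{n-\dim H}$, the number of translates $H+g$. A subspace $H\le\mathbb{Z}_2^n$ is an $\epsilon$-regular subspace for $f:\mathbb{Z}_2^n\to[0,1]$ if $f|_A$ is $\epsilon$-regular for at least $(1-\epsilon)|\mathbb{Z}_2^n/H|$ translates $A$ of $H$. $M(\epsilon)$ denotes the least integer $M$ such that for every $n$ and every $f:\mathbb{Z}_2^n\to[0,1]$ there is an $\epsilon$-regular subspace for $f$ of index at most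 $M$ (this is finite by Green's arithmetic regularity lemma). The tower function is $\operatorname{twr}(0)=1$ and $\operatorname{twr}(h)=2^{\operatorname{twr}(h-1)}$ for positive integers $h$. *)

theory Defs
  imports Complex_Main "HOL-Library.Z2" "HOL-Library.Function_Algebras"
    "HOL-Library.FuncSet" "HOL-Library.Extended_Nat"
begin

text \<open>
  The dimension is quantified inside the statements, so vectors over the two-element field
  \<^typ>\<open>bit\<close> are functions \<^typ>\<open>nat \<Rightarrow> bit\<close>, and
  \<open>\<int>\<^sub>2\<^sup>n\<close> consists of those vanishing at all indices \<open>\<ge> n\<close>. Addition is the pointwise one.
\<close>

definition Z2vec :: "nat \<Rightarrow> (nat \<Rightarrow> bit) set" where
  "Z2vec n = {x. \<forall>i\<ge>n. x i = 0}"

global_interpretation Z2: vector_space "\<lambda>(c::bit) (x :: nat \<Rightarrow> bit) i. c * x i"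
  defines Z2_subspace = Z2.subspace
  by unfold_locales (auto simp: fun_eq_iff algebra_simps)

definition Z2_linear_subspace :: "nat \<Rightarrow> (nat \<Rightarrow> bit) set \<Rightarrow> bool" where
  "Z2_linear_subspace n H \<longleftrightarrow> H \<subseteq> Z2vec n \<and> Z2_subspace H"

definition Z2_inner :: "nat \<Rightarrow> (nat \<Rightarrow> bit) \<Rightarrow> (nat \<Rightarrow> bit) \<Rightarrow> bit" where
  "Z2_inner n x y = (\<Sum>i<n. x i * y i)"

definition Z2_perp :: "nat \<Rightarrow> (nat \<Rightarrow> bit) set \<Rightarrow> (nat \<Rightarrow> bit) set" where
  "Z2_perp n H = {y \<in> Z2vec n. \<forall>x\<in>H. Z2_inner n x y = 0}"

definition translates :: "nat \<Rightarrow> (nat \<Rightarrow> bit) set \<Rightarrow> (nat \<Rightarrow> bit) set set" where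
  "translates n H = {(\<lambda>h. h + g) ` H | g. g \<in> Z2vec n}"

definition subspace_index :: "nat \<Rightarrow> (nat \<Rightarrow> bit) set \<Rightarrow> nat" where
  "subspace_index n H = card (translates n H)"

definition fourier_coeff ::
    "nat \<Rightarrow> (nat \<Rightarrow> bit) set \<Rightarrow> ((nat \<Rightarrow> bit) \<Rightarrow> real) \<Rightarrow> (nat \<Rightarrow> bit) \<Rightarrow> real" where
  "fourier_coeff n A f \<eta> =
     1 / real (card A) * (\<Sum>x\<in>A. f x * (-1) ^ (of_bool (Z2_inner n x \<eta> = 1) :: nat))"

text \<open>
  Regularity of the restriction of \<open>f\<close> to a translate \<open>A\<close> of the linear subspace \<open>H\<close>; only the
  values of \<open>f\<close> on \<open>A\<close> matter. For \<open>H = {0}\<close> there is no \<open>\<eta> \<notin> H\<^sup>\<bottom>\<close>, and the condition holds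
  vacuously.
\<close>

definition regular_on ::
    "nat \<Rightarrow> real \<Rightarrow> (nat \<Rightarrow> bit) set \<Rightarrow> (nat \<Rightarrow> bit) set \<Rightarrow> ((nat \<Rightarrow> bit) \<Rightarrow> real) \<Rightarrow> bool" where
  "regular_on n \<epsilon> H A f \<longleftrightarrow> (\<forall>\<eta> \<in> Z2vec n - Z2_perp n H. \<bar>fourier_coeff n A f \<eta>\<bar> \<le> \<epsilon>)"

definition regular_subspace ::
    "nat \<Rightarrow> real \<Rightarrow> ((nat \<Rightarrow> bit) \<Rightarrow> real) \<Rightarrow> (nat \<Rightarrow> bit) set \<Rightarrow> bool" where
  "regular_subspace n \<epsilon> f H \<longleftrightarrow> Z2_linear_subspace n H \<and>
     real (card {A \<in> translates n H. regular_on n \<epsilon> H A f}) \<ge> (1 - \<epsilon>) * real (subspace_index n H)"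

definition regularity_bound :: "real \<Rightarrow> nat \<Rightarrow> bool" where
  "regularity_bound \<epsilon> M \<longleftrightarrow> (\<forall>n. \<forall>f \<in> Z2vec n \<rightarrow> {0..1}.
     \<exists>H. regular_subspace n \<epsilon> f H \<and> subspace_index n H \<le> M)"

text \<open>
  The least regularity bound. The value is extended natural so that the definition does not
  presuppose the arithmetic regularity lemma: it would be \<open>\<infinity>\<close> if no bound existed.
\<close>

definition regularity_M :: "real \<Rightarrow> enat" where
  "regularity_M \<epsilon> = Inf {enat M | M. regularity_bound \<epsilon> M}"

lemma regularity_M_eq_Least:
  assumes "regularity_bound \<epsilon> M"
  shows "regularity_M \<epsilon> = enat (LEAST M. regularity_bound \<epsilon> M)"
  unfolding regularity_M_def
proof (rule antisym)
  show "Inf {enat M | M. regularity_bound \<epsilon> M} \<le> enat (LEAST M. regularity_bound \<epsilon> M)"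
    using LeastI[of "regularity_bound \<epsilon>", OF assms] by (auto intro!: Inf_lower)
  show "enat (LEAST M. regularity_bound \<epsilon> M) \<le> Inf {enat M | M. regularity_bound \<epsilon> M}"
    by (auto intro!: Inf_greatest Least_le)
qed

fun twr :: "nat \<Rightarrow> nat" where
  "twr 0 = 1"
| "twr (Suc h) = 2 ^ twr h"

end

theory Submission
  imports Defs
begin

text \<open>
  Cut the coordinates into \<open>s\<close> consecutive blocks of tower-type growing length. To every \<open>y\<close>
  that lives on the coordinates before block \<open>i\<close> attach a nonzero vector \<open>\<xi> i y\<close> supported on
  block \<open>i\<close>, in such a way that every \<open>h\<close> that is nonzero somewhere on block \<open>i\<close> is nonorthogonal
  to more than a fraction \<open>1/14\<close> of these vectors; since there are \<open>2 ^ D i\<close> of them, block \<open>i\<close>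
  can have length about half that number. Let \<open>f\<close> be the average over \<open>i\<close> of the indicators of
  \<open>\<langle>x, \<xi> i y\<rangle> = 0\<close>, where \<open>y\<close> is the part of \<open>x\<close> before block \<open>i\<close>.

  Suppose that an \<open>\<epsilon>\<close>-regular \<open>H\<close> vanishes before block \<open>i\<close>, and that \<open>h \<in> H\<close> does not vanish
  on block \<open>i\<close>. Fix \<open>y\<close> with \<open>\<langle>h, \<xi> i y\<rangle> = 1\<close> and average the Fourier coefficient at \<open>\<xi> i y\<close>
  over the cosets of \<open>H\<close> inside the fibre over \<open>y\<close>. All layers but the \<open>i\<close>-th one cancel exactly,
  so the average is \<open>1/(2s) \<ge> 8\<epsilon>\<close>. As each coefficient is at most \<open>1/2\<close>, a fraction of at least
  \<open>14\<epsilon>\<close> of these cosets is irregular, and summing over \<open>y\<close> gives more than \<open>\<epsilon>\<close> overall. Hence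
  \<open>H\<close> vanishes on every block, that is, \<open>H = {0}\<close>.
\<close>

section \<open>Vectors with prescribed support, characters and sign cancellation\<close>

definition supported_on :: "nat set \<Rightarrow> (nat \<Rightarrow> bit) set" where
  "supported_on K = {x. \<forall>k. k \<notin> K \<longrightarrow> x k = 0}"

definition chi :: "nat \<Rightarrow> (nat \<Rightarrow> bit) \<Rightarrow> (nat \<Rightarrow> bit) \<Rightarrow> real" where
  "chi n \<eta> x = (-1) ^ (of_bool (Z2_inner n x \<eta> = 1) :: nat)"

definition unit_vec :: "nat \<Rightarrow> nat \<Rightarrow> bit" where
  "unit_vec k = (\<lambda>j. of_bool (j = k))"

definition trunc :: "nat \<Rightarrow> (nat \<Rightarrow> bit) \<Rightarrow> nat \<Rightarrow> bit" where
  "trunc m x = (\<lambda>k. if k < m then x k else 0)"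

lemma Z2vec_eq_supported_on: "Z2vec n = supported_on {..<n}"
  by (auto simp: Z2vec_def supported_on_def)

lemma supported_on_eq_image:
  "supported_on K = (\<lambda>S k. of_bool (k \<in> S)) ` Pow K"
proof (intro equalityI subsetI)
  fix x assume x: "x \<in> supported_on K"
  have "x = (\<lambda>k. of_bool (k \<in> {k. x k \<noteq> 0}))"
    by (rule ext) (auto simp: of_bool_def)
  moreover have "{k. x k \<noteq> 0} \<in> Pow K"
    using x by (auto simp: supported_on_def)
  ultimately show "x \<in> (\<lambda>S k. of_bool (k \<in> S)) ` Pow K"
    by (rule image_eqI)
qed (auto simp: supported_on_def)

lemma finite_supported_on [simp]: "finite K \<Longrightarrow> finite (supported_on K)"
  by (simp add: supported_on_eq_image)

lemma card_supported_on: 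
  assumes "finite K"
  shows "card (supported_on K) = 2 ^ card K"
proof -
  have "inj_on (\<lambda>S k. of_bool (k \<in> S) :: bit) (Pow K)"
    by (auto simp: inj_on_def fun_eq_iff)
  then show ?thesis
    using assms by (simp add: supported_on_eq_image card_image card_Pow)
qed

lemma finite_Z2vec [simp]: "finite (Z2vec n)"
  by (simp add: Z2vec_eq_supported_on)

lemma card_Z2vec: "card (Z2vec n) = 2 ^ n"
  by (simp add: Z2vec_eq_supported_on card_supported_on)

lemma zero_in_supported_on [simp]: "0 \<in> supported_on K"
  by (simp add: supported_on_def)

lemma add_in_supported_on:
  "x \<in> supported_on K \<Longrightarrow> y \<in> supported_on K \<Longrightarrow> x + y \<in> supported_on K"
  by (simp add: supported_on_def)

lemma supported_on_mono: "K \<subseteq> L \<Longrightarrow> supported_on K \<subseteq> supported_on L"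
  by (auto simp: supported_on_def)

lemma unit_vec_in_supported_on: "k \<in> K \<Longrightarrow> unit_vec k \<in> supported_on K"
  by (auto simp: unit_vec_def supported_on_def)

lemma supported_on_nonzeroE:
  assumes "\<eta> \<in> supported_on K - {0}"
  obtains k where "k \<in> K" "\<eta> k = 1"
proof -
  have "\<eta> \<noteq> 0" using assms by simp
  then obtain k where "\<eta> k \<noteq> 0" by (metis ext zero_fun_apply)
  moreover from this have "k \<in> K" using assms by (auto simp: supported_on_def)
  ultimately show ?thesis using that by simp
qed

lemma Z2_add_self [simp]: "(x :: nat \<Rightarrow> bit) + (x + y) = y" "x + y + y = x"
  by (auto simp: fun_eq_iff)

lemma Z2_inner_commute: "Z2_inner n x y = Z2_inner n y x"
  by (simp only: Z2_inner_def mult.commute)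

lemma Z2_inner_add_left: "Z2_inner n (x + y) z = Z2_inner n x z + Z2_inner n y z"
  by (simp only: Z2_inner_def plus_fun_apply distrib_right sum.distrib)

lemma Z2_inner_unit_vec:
  assumes "k < n" shows "Z2_inner n (unit_vec k) y = y k"
proof -
  have "Z2_inner n (unit_vec k) y = (\<Sum>i<n. if i = k then y i else 0)"
    unfolding Z2_inner_def unit_vec_def by (intro sum.cong) auto
  then show ?thesis using assms by simp
qed

lemma chi_add: "chi n \<eta> (x + y) = chi n \<eta> x * chi n \<eta> y"
  by (cases "Z2_inner n x \<eta>"; cases "Z2_inner n y \<eta>")
    (simp_all add: chi_def Z2_inner_add_left)

lemma chi_cases: "chi n \<eta> x = (if Z2_inner n x \<eta> = 1 then -1 else 1)"
  by (simp add: chi_def)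

lemma abs_chi [simp]: "\<bar>chi n \<eta> x\<bar> = 1"
  by (simp add: chi_cases)

lemma chi_square [simp]: "chi n \<eta> x * chi n \<eta> x = 1"
  by (simp add: chi_cases)

text \<open>All exact cancellations below come from this: translate by a vector that flips the sign
  of the summand. Fixed points of the involution do no harm, since \<open>g\<close> vanishes
  there.\<close>

lemma sum_eq_zero_by_involution:
  fixes g :: "'a \<Rightarrow> real"
  assumes "\<And>x. x \<in> S \<Longrightarrow> \<phi> x \<in> S" "\<And>x. x \<in> S \<Longrightarrow> \<phi> (\<phi> x) = x"
    "\<And>x. x \<in> S \<Longrightarrow> g (\<phi> x) = - g x"
  shows "sum g S = 0"
proof -
  have "sum g S = (\<Sum>x\<in>S. - g x)"
    by (rule sum.reindex_bij_witness[of _ \<phi> \<phi>]) (use assms in auto)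
  then show ?thesis by (simp add: sum_negf)
qed

section \<open>Vectors that no nonzero vector is mostly orthogonal to\<close>

lemma sum_weight_le:
  fixes z :: real
  assumes K: "K \<subseteq> {..<n}" and k: "k \<in> K" "\<eta> k \<noteq> 0" and z: "z \<le> 1"
  shows "(\<Sum>w\<in>supported_on K - {0}. z ^ (of_bool (Z2_inner n \<eta> w = 1) :: nat))
    \<le> real (card (supported_on K - {0})) * ((1 + z) / 2)"
proof -
  have fin: "finite (supported_on K)"
    using K finite_subset by (auto intro: finite_supported_on)
  have "(\<Sum>w\<in>supported_on K. chi n \<eta> w) = 0"
  proof (rule sum_eq_zero_by_involution[where \<phi> = "\<lambda>w. w + unit_vec k"])
    fix w
    have "Z2_inner n (unit_vec k) \<eta> = 1"
      using Z2_inner_unit_vec[of k n \<eta>] k K by (auto simp: subset_eq)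
    then show "chi n \<eta> (w + unit_vec k) = - chi n \<eta> w"
      by (simp add: chi_add) (simp add: chi_cases)
  qed (use k unit_vec_in_supported_on in \<open>auto intro: add_in_supported_on\<close>)
  then have *: "(\<Sum>w\<in>supported_on K - {0}. chi n \<eta> w) = - 1"
    using fin by (simp add: sum_diff1 chi_def Z2_inner_def)
  \<comment> \<open>The weight is affine in the character: 1 where the sign is 1, \<open>z\<close>
    where it is -1. Over the whole space the mean would be exactly \<open>(1 + z) / 2\<close>; the
    omitted \<open>w = 0\<close> has the largest weight, so the mean only falls.\<close>
  have "(\<Sum>w\<in>supported_on K - {0}. z ^ (of_bool (Z2_inner n \<eta> w = 1) :: nat))
    = (\<Sum>w\<in>supported_on K - {0}. (1 + z) / 2 + (1 - z) / 2 * chi n \<eta> w)"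
    by (intro sum.cong) (auto simp: chi_cases Z2_inner_commute[of n \<eta>] field_simps)
  also have "\<dots> = real (card (supported_on K - {0})) * ((1 + z) / 2) - (1 - z) / 2"
    by (simp only: sum.distrib * flip: sum_distrib_left) simp
  finally show ?thesis using z by simp
qed

text \<open>A derandomised Gilbert--Varshamov argument: each new vector is chosen so that the total
  weight drops at least as much as for a uniformly random nonzero one.\<close>

lemma ex_small_weight_assignment:
  fixes z :: real
  assumes K: "K \<subseteq> {..<n}" "K \<noteq> {}" and z: "0 \<le> z" "z \<le> 1" and S: "finite S"
  shows "\<exists>\<xi>. (\<forall>g\<in>S. \<xi> g \<in> supported_on K - {0}) \<and>
    (\<Sum>\<eta>\<in>supported_on K - {0}. z ^ card {g\<in>S. Z2_inner n \<eta> (\<xi> g) = 1})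
      \<le> real (card (supported_on K - {0})) * ((1 + z) / 2) ^ card S"
  using S
proof (induction S rule: finite_induct)
  case empty
  show ?case by simp
next
  case (insert a S)
  define W where "W = supported_on K - {0}"
  have fin: "finite W"
    using K(1) finite_subset by (auto simp: W_def intro: finite_supported_on)
  obtain k where k: "k \<in> K" using K by auto
  have "unit_vec k \<in> W"
    using unit_vec_in_supported_on[OF k] by (auto simp: W_def unit_vec_def fun_eq_iff)
  then have W_pos: "real (card W) > 0"
    using fin by (auto simp: card_gt_0_iff)
  obtain \<xi> where \<xi>: "\<forall>g\<in>S. \<xi> g \<in> W" and
    le: "(\<Sum>\<eta>\<in>W. z ^ card {g\<in>S. Z2_inner n \<eta> (\<xi> g) = 1}) \<le> real (card W) * ((1 + z) / 2) ^ card S"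
    using insert.IH unfolding W_def by blast
  define c where "c \<eta> = z ^ card {g\<in>S. Z2_inner n \<eta> (\<xi> g) = 1}" for \<eta>
  define wt where "wt \<eta> w = z ^ (of_bool (Z2_inner n \<eta> w = 1) :: nat)" for \<eta> w
  \<comment> \<open>\<open>c \<eta>\<close> is the weight so far and \<open>wt \<eta> w\<close> the
    factor that a new vector \<open>w\<close> contributes. If every \<open>w\<close> did worse than
    claimed, summing over \<open>w\<close> and swapping the sums would contradict
    \<open>sum_weight_le\<close>.\<close>
  have "\<exists>w\<in>W. (\<Sum>\<eta>\<in>W. c \<eta> * wt \<eta> w) \<le> (1 + z) / 2 * sum c W"
  proof (rule ccontr)
    assume "\<not> ?thesis"
    then have "(\<Sum>w\<in>W. (1 + z) / 2 * sum c W) < (\<Sum>w\<in>W. \<Sum>\<eta>\<in>W. c \<eta> * wt \<eta> w)"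
      using fin \<open>unit_vec k \<in> W\<close> by (intro sum_strict_mono) auto
    also have "\<dots> = (\<Sum>\<eta>\<in>W. c \<eta> * (\<Sum>w\<in>W. wt \<eta> w))"
      by (subst sum.swap) (simp add: sum_distrib_left)
    also have "\<dots> \<le> (\<Sum>\<eta>\<in>W. c \<eta> * (real (card W) * ((1 + z) / 2)))"
    proof (intro sum_mono mult_left_mono)
      fix \<eta> assume "\<eta> \<in> W"
      then obtain j where "j \<in> K" "\<eta> j \<noteq> 0"
        unfolding W_def by (metis supported_on_nonzeroE bit_not_zero_iff)
      then show "(\<Sum>w\<in>W. wt \<eta> w) \<le> real (card W) * ((1 + z) / 2)"
        unfolding W_def wt_def by (intro sum_weight_le[OF K(1) _ _ z(2)])
      show "0 \<le> c \<eta>" using z by (simp add: c_def)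
    qed
    also have "\<dots> = (\<Sum>w\<in>W. (1 + z) / 2 * sum c W)"
      by (simp only: sum_distrib_right[symmetric] sum_constant) (simp only: mult_ac)
    finally show False by simp
  qed
  then obtain w where w: "w \<in> W" "(\<Sum>\<eta>\<in>W. c \<eta> * wt \<eta> w) \<le> (1 + z) / 2 * sum c W"
    by auto
  define \<xi>' where "\<xi>' = \<xi>(a := w)"
  have "z ^ card {g\<in>insert a S. Z2_inner n \<eta> (\<xi>' g) = 1} = c \<eta> * wt \<eta> w" for \<eta>
  proof -
    have "{g\<in>insert a S. Z2_inner n \<eta> (\<xi>' g) = 1} =
      (if Z2_inner n \<eta> w = 1 then insert a {g\<in>S. Z2_inner n \<eta> (\<xi> g) = 1}
       else {g\<in>S. Z2_inner n \<eta> (\<xi> g) = 1})"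
      using insert.hyps by (auto simp: \<xi>'_def)
    then show ?thesis
      using insert.hyps by (simp add: c_def wt_def)
  qed
  then have "(\<Sum>\<eta>\<in>W. z ^ card {g\<in>insert a S. Z2_inner n \<eta> (\<xi>' g) = 1}) \<le> (1 + z) / 2 * sum c W"
    using w by simp
  also have "\<dots> \<le> (1 + z) / 2 * (real (card W) * ((1 + z) / 2) ^ card S)"
    using le z by (intro mult_left_mono) (auto simp: c_def)
  also have "\<dots> = real (card W) * ((1 + z) / 2) ^ card (insert a S)"
    using insert.hyps by simp
  finally have "(\<Sum>\<eta>\<in>W. z ^ card {g\<in>insert a S. Z2_inner n \<eta> (\<xi>' g) = 1}) \<le> \<dots>" .
  moreover have "\<forall>g\<in>insert a S. \<xi>' g \<in> W"
    using \<xi> w by (simp add: \<xi>'_def)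
  ultimately show ?case unfolding W_def by blast
qed

text \<open>The 14 is tied to \<open>irregular_in_fibre_ge\<close>: a proportion
  \<open>14 * \<epsilon>\<close> of irregular points in each of more than 1/14 of the fibres makes
  more than \<open>\<epsilon>\<close> in total.\<close>

definition spread :: "nat \<Rightarrow> 'a set \<Rightarrow> nat set \<Rightarrow> ('a \<Rightarrow> nat \<Rightarrow> bit) \<Rightarrow> bool" where
  "spread n S K \<xi> \<longleftrightarrow> (\<forall>g\<in>S. \<xi> g \<in> supported_on K - {0}) \<and>
    (\<forall>\<eta>\<in>supported_on K - {0}. card S < 14 * card {g\<in>S. Z2_inner n \<eta> (\<xi> g) = 1})"

lemma spread_nonzero: "spread n S K \<xi> \<Longrightarrow> g \<in> S \<Longrightarrow> \<xi> g \<in> supported_on K - {0}"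
  by (simp add: spread_def)

text \<open>The vectors \<open>\<xi> g\<close> live on \<open>K\<close>, so an arbitrary
  \<open>h\<close> may be replaced by its part on \<open>K\<close> without changing the inner
  products.\<close>

lemma spread_card_gt:
  assumes spread: "spread n S K \<xi>" and h: "k \<in> K" "h k \<noteq> 0"
  shows "card S < 14 * card {g\<in>S. Z2_inner n h (\<xi> g) = 1}"
proof -
  define \<eta> where "\<eta> k = (if k \<in> K then h k else 0)" for k
  have "\<eta> k \<noteq> 0" using h by (simp add: \<eta>_def)
  then have "\<eta> \<noteq> 0" by auto
  then have "\<eta> \<in> supported_on K - {0}"
    by (simp add: \<eta>_def supported_on_def)
  moreover have "Z2_inner n h (\<xi> g) = Z2_inner n \<eta> (\<xi> g)" if "g \<in> S" for g
    unfolding Z2_inner_def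
    by (rule sum.cong[OF refl])
      (use spread_nonzero[OF spread that] in \<open>auto simp: \<eta>_def supported_on_def\<close>)
  then have "{g\<in>S. Z2_inner n h (\<xi> g) = 1} = {g\<in>S. Z2_inner n \<eta> (\<xi> g) = 1}" by auto
  ultimately show ?thesis
    using spread by (simp add: spread_def)
qed

text \<open>With \<open>z = 1/4\<close>, an \<eta> that is nonorthogonal to too few of the vectors
  would by itself outweigh the bound on the total weight.\<close>

lemma ex_spread_assignment_half:
  assumes K: "K \<subseteq> {..<n}" "K \<noteq> {}" and S: "finite S" and le: "2 * card K \<le> card S"
  shows "\<exists>\<xi>. spread n S K \<xi>"
proof -
  define W where "W = supported_on K - {0}"
  have finK: "finite K" using K(1) finite_subset by blast
  then have fin: "finite W" by (simp add: W_def)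
  have cardW: "real (card W) < 2 ^ card K"
    using finK by (simp add: W_def card_supported_on of_nat_diff)
  obtain \<xi> where \<xi>: "\<forall>g\<in>S. \<xi> g \<in> W" and
    sum_le: "(\<Sum>\<eta>\<in>W. (1/4 :: real) ^ card {g\<in>S. Z2_inner n \<eta> (\<xi> g) = 1})
      \<le> real (card W) * (5/8) ^ card S"
    using ex_small_weight_assignment[OF K _ _ S, of "1/4"] by (auto simp: W_def)
  have "card S < 14 * card {g\<in>S. Z2_inner n \<eta> (\<xi> g) = 1}" if "\<eta> \<in> W" for \<eta>
  proof (rule ccontr)
    define b where "b = card {g\<in>S. Z2_inner n \<eta> (\<xi> g) = 1}"
    assume "\<not> ?thesis"
    then have b: "14 * b \<le> card S" by (simp add: b_def)
    have "(1/4 :: real) ^ b \<le> (\<Sum>\<eta>\<in>W. (1/4) ^ card {g\<in>S. Z2_inner n \<eta> (\<xi> g) = 1})"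
      unfolding b_def by (rule member_le_sum[OF that]) (use fin in auto)
    also have "\<dots> \<le> real (card W) * (5/8) ^ card S" by (rule sum_le)
    also have "\<dots> < 2 ^ card K * (5/8) ^ card S"
      using cardW by simp
    finally have *: "(1/4 :: real) ^ b < 2 ^ card K * (5/8) ^ card S" .
    \<comment> \<open>Taking 14th powers avoids the fractional exponent \<open>card S / 14\<close>.
      What remains is that \<open>2 ^ 7 * (5/8) ^ 14\<close>, about 0.18, is at most 1/4.\<close>
    have "(1/4 :: real) ^ card S \<le> (1/4) ^ (14 * b)"
      using b by (intro power_decreasing) auto
    also have "\<dots> = ((1/4) ^ b) ^ 14"
      by (simp only: power_mult[symmetric] mult.commute)
    also have "\<dots> < (2 ^ card K * (5/8) ^ card S) ^ 14"
      using * by (intro power_strict_mono) auto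
    also have "\<dots> = 2 ^ (7 * (2 * card K)) * ((5/8) ^ 14) ^ card S"
      by (simp only: power_mult_distrib power_mult[symmetric]) (simp add: mult.commute)
    also have "\<dots> \<le> 2 ^ (7 * card S) * ((5/8) ^ 14) ^ card S"
      using le by (intro mult_right_mono power_increasing) auto
    also have "\<dots> = (2 ^ 7 * (5/8) ^ 14) ^ card S"
      by (simp only: power_mult power_mult_distrib)
    also have "\<dots> \<le> (1/4) ^ card S"
      by (intro power_mono) (simp_all add: power_divide)
    finally show False by simp
  qed
  then show ?thesis using \<xi> unfolding W_def spread_def by blast
qed

text \<open>For fewer than 14 vectors a single nonorthogonal one suffices, and the unit vectors of
  \<open>K\<close> provide it: a nonzero \<eta> has a nonzero coordinate.\<close>

lemma ex_spread_assignment_small: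
  assumes K: "K \<subseteq> {..<n}" and S: "finite S" and card: "card K = card S" "card S < 14"
  shows "\<exists>\<xi>. spread n S K \<xi>"
proof -
  have "finite K" using K finite_subset by blast
  then obtain \<beta> where \<beta>: "bij_betw \<beta> S K"
    using finite_same_card_bij[OF S] card by metis
  define \<xi> where "\<xi> g = unit_vec (\<beta> g)" for g
  have \<beta>K: "\<beta> g \<in> K" if "g \<in> S" for g using \<beta> that by (auto simp: bij_betw_def)
  have "card S < 14 * card {g\<in>S. Z2_inner n \<eta> (\<xi> g) = 1}" if \<eta>: "\<eta> \<in> supported_on K - {0}" for \<eta>
  proof -
    obtain k where k: "k \<in> K" "\<eta> k = 1"
      using \<eta> by (rule supported_on_nonzeroE)
    then obtain g where g: "g \<in> S" "\<beta> g = k" using \<beta> by (auto simp: bij_betw_def)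
    have "Z2_inner n \<eta> (\<xi> g) = 1"
      using k g K by (subst Z2_inner_commute) (auto simp: \<xi>_def Z2_inner_unit_vec subset_eq)
    then have "card {g\<in>S. Z2_inner n \<eta> (\<xi> g) = 1} > 0"
      using g S by (auto simp: card_gt_0_iff)
    then show ?thesis using card by linarith
  qed
  moreover have "\<forall>g\<in>S. \<xi> g \<in> supported_on K - {0}"
    using \<beta>K unit_vec_in_supported_on by (auto simp: \<xi>_def unit_vec_def fun_eq_iff)
  ultimately show ?thesis unfolding spread_def by blast
qed

section \<open>Cosets of a subspace, counted through their points\<close>

abbreviation coset :: "(nat \<Rightarrow> bit) set \<Rightarrow> (nat \<Rightarrow> bit) \<Rightarrow> (nat \<Rightarrow> bit) set" where
  "coset H x \<equiv> (\<lambda>h. h + x) ` H"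

lemma Z2_subspace_iff:
  "Z2_subspace H \<longleftrightarrow> 0 \<in> H \<and> (\<forall>x\<in>H. \<forall>y\<in>H. x + y \<in> H)"
proof -
  have "(\<lambda>i. c * x i) \<in> H" if "0 \<in> H" "x \<in> H" for c and x :: "nat \<Rightarrow> bit"
    using that by (cases c) (simp_all add: zero_fun_def del: mult_bit_eq_and)
  then show ?thesis by (auto simp: Z2.subspace_def)
qed

lemma translates_eq_image: "translates n H = coset H ` Z2vec n"
  by (auto simp: translates_def)

lemma card_coset: "card (coset H x) = card H"
  by (intro card_image) (auto simp: inj_on_def)

lemma coset_eq:
  assumes "Z2_subspace H" "y \<in> coset H x"
  shows "coset H y = coset H x"
proof -
  obtain h where h: "h \<in> H" "y = h + x" using assms by auto
  have closed: "\<And>a b. a \<in> H \<Longrightarrow> b \<in> H \<Longrightarrow> a + b \<in> H"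
    using assms by (auto simp: Z2_subspace_iff)
  show ?thesis
  proof (intro equalityI subsetI)
    fix z assume "z \<in> coset H y"
    then obtain k where "k \<in> H" "z = (k + h) + x" using h by (auto simp: add.assoc)
    then show "z \<in> coset H x" using closed h by blast
  next
    fix z assume "z \<in> coset H x"
    then obtain k where "k \<in> H" "z = (k + h) + y" using h by (auto simp: add.assoc)
    then show "z \<in> coset H y" using closed h by blast
  qed
qed

text \<open>The translates partition the space into classes of size \<open>card H\<close>.
  Proportions of translates thus become proportions of points, and no coset representatives have to
  be chosen.\<close>

lemma card_points_eq_card_translates:
  assumes H: "Z2_linear_subspace n H"
  shows "card {x \<in> Z2vec n. P (coset H x)} = card H * card {A \<in> translates n H. P A}"
proof -
  have sub: "Z2_subspace H" and HG: "H \<subseteq> supported_on {..<n}"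
    using H by (auto simp: Z2_linear_subspace_def Z2vec_eq_supported_on)
  let ?C = "{A \<in> translates n H. P A}"
  have self: "x \<in> coset H x" for x
    using sub by (auto simp: Z2_subspace_iff intro!: image_eqI[of _ _ 0])
  have inG: "coset H x \<subseteq> Z2vec n" if "x \<in> Z2vec n" for x
    using that HG by (auto simp: Z2vec_eq_supported_on intro: add_in_supported_on)
  have Un: "\<Union>?C = {x \<in> Z2vec n. P (coset H x)}"
  proof (intro equalityI subsetI)
    fix y assume "y \<in> \<Union>?C"
    then obtain x where x: "x \<in> Z2vec n" "y \<in> coset H x" "P (coset H x)"
      by (auto simp: translates_eq_image)
    then show "y \<in> {x \<in> Z2vec n. P (coset H x)}"
      using coset_eq[OF sub x(2)] inG by auto
  next
    fix y assume "y \<in> {x \<in> Z2vec n. P (coset H x)}"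
    then show "y \<in> \<Union>?C"
      using self[of y] by (auto simp: translates_eq_image)
  qed
  have "card H * card ?C = card (\<Union>?C)"
  proof (rule card_partition)
    show "finite ?C" by (simp add: translates_eq_image)
    show "finite (\<Union>?C)" unfolding Un by simp
    show "card c = card H" if "c \<in> ?C" for c
      using that card_coset by (auto simp: translates_eq_image)
    fix A B assume AB: "A \<in> ?C" "B \<in> ?C" "A \<noteq> B"
    then obtain x y where "A = coset H x" "B = coset H y"
      by (auto simp: translates_eq_image)
    with AB(3) show "A \<inter> B = {}"
      using coset_eq[OF sub] by (metis disjoint_iff)
  qed
  then show ?thesis by (simp add: Un)
qed

section \<open>Fourier coefficients on cosets\<close>

lemma fourier_coeff_chi:
  "fourier_coeff n A f \<eta> = (\<Sum>x\<in>A. f x * chi n \<eta> x) / real (card A)"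
  by (simp add: fourier_coeff_def chi_def)

lemma card_irregular_points_le:
  assumes "regular_subspace n \<epsilon> f H"
  shows "real (card {x \<in> Z2vec n. \<not> regular_on n \<epsilon> H (coset H x) f}) \<le> \<epsilon> * 2 ^ n"
proof -
  have H: "Z2_linear_subspace n H"
    and le: "real (card {A \<in> translates n H. regular_on n \<epsilon> H A f}) \<ge> (1 - \<epsilon>) * real (subspace_index n H)"
    using assms by (auto simp: regular_subspace_def)
  let ?R = "{x \<in> Z2vec n. regular_on n \<epsilon> H (coset H x) f}"
  have all: "card H * subspace_index n H = 2 ^ n"
    using card_points_eq_card_translates[OF H, of "\<lambda>_. True"]
    by (simp add: subspace_index_def card_Z2vec)
  have "(1 - \<epsilon>) * 2 ^ n = real (card H) * ((1 - \<epsilon>) * real (subspace_index n H))"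
    using all by (metis (mono_tags) mult.left_commute of_nat_mult of_nat_numeral of_nat_power)
  also have "\<dots> \<le> real (card H) * real (card {A \<in> translates n H. regular_on n \<epsilon> H A f})"
    using le by (intro mult_left_mono) auto
  also have "\<dots> = real (card ?R)"
    using card_points_eq_card_translates[OF H, of "\<lambda>A. regular_on n \<epsilon> H A f"] by simp
  finally have R: "(1 - \<epsilon>) * 2 ^ n \<le> real (card ?R)" .
  have "{x \<in> Z2vec n. \<not> regular_on n \<epsilon> H (coset H x) f} = Z2vec n - ?R" by auto
  then have "card {x \<in> Z2vec n. \<not> regular_on n \<epsilon> H (coset H x) f} = 2 ^ n - card ?R"
    by (simp add: card_Diff_subset card_Z2vec)
  moreover have "card ?R \<le> 2 ^ n"
    using card_mono[of "Z2vec n" ?R] by (simp add: card_Z2vec)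
  ultimately show ?thesis
    using R by (simp add: of_nat_diff algebra_simps)
qed

text \<open>Expand each coefficient as a mean over \<open>h \<in> H\<close>. For fixed
  \<open>h\<close> the translation by \<open>h\<close> permutes \<open>B\<close>, so all
  \<open>card H\<close> inner sums agree.\<close>

lemma sum_fourier_coeff_cosets:
  assumes H: "finite H" "H \<noteq> {}" and B: "\<And>x h. x \<in> B \<Longrightarrow> h \<in> H \<Longrightarrow> h + x \<in> B"
  shows "(\<Sum>x\<in>B. fourier_coeff n (coset H x) f \<eta>) = (\<Sum>x\<in>B. f x * chi n \<eta> x)"
proof -
  have pos: "real (card H) \<noteq> 0" using H by auto
  have "(\<Sum>x\<in>B. fourier_coeff n (coset H x) f \<eta>) =
    (\<Sum>x\<in>B. \<Sum>h\<in>H. f (h + x) * chi n \<eta> (h + x)) / real (card H)"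
    unfolding sum_divide_distrib[of _ B]
    by (intro sum.cong) (auto simp: fourier_coeff_chi card_coset sum.reindex inj_on_def)
  also have "(\<Sum>x\<in>B. \<Sum>h\<in>H. f (h + x) * chi n \<eta> (h + x)) =
    (\<Sum>h\<in>H. \<Sum>x\<in>B. f (h + x) * chi n \<eta> (h + x))"
    by (rule sum.swap)
  also have "\<dots> = (\<Sum>h\<in>H. \<Sum>x\<in>B. f x * chi n \<eta> x)"
  proof (rule sum.cong[OF refl])
    fix h assume "h \<in> H"
    then show "(\<Sum>x\<in>B. f (h + x) * chi n \<eta> (h + x)) = (\<Sum>x\<in>B. f x * chi n \<eta> x)"
      by (intro sum.reindex_bij_witness[of _ "\<lambda>x. h + x" "\<lambda>x. h + x"]) (auto simp: B)
  qed
  finally show ?thesis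
    using pos by (simp only: sum_constant nonzero_mult_div_cancel_left not_False_eq_True)
qed

text \<open>Translation by \<open>h\<close> flips the character, which therefore has mean zero on
  the coset. Hence \<open>f\<close> may be replaced by \<open>f - 1/2\<close>, of absolute value at
  most 1/2.\<close>

lemma abs_fourier_coeff_le_half:
  assumes H: "Z2_linear_subspace n H" and f: "f \<in> Z2vec n \<rightarrow> {0..1}"
    and x: "x \<in> Z2vec n" and h: "h \<in> H" "Z2_inner n h \<eta> = 1"
  shows "\<bar>fourier_coeff n (coset H x) f \<eta>\<bar> \<le> 1/2"
proof -
  let ?A = "coset H x"
  have sub: "Z2_subspace H" and HG: "H \<subseteq> Z2vec n"
    using H by (auto simp: Z2_linear_subspace_def)
  have AG: "?A \<subseteq> Z2vec n"
    using x HG by (auto simp: Z2vec_eq_supported_on intro: add_in_supported_on)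
  have "finite H" using finite_subset[OF HG] by simp
  then have pos: "real (card ?A) > 0" using h by (auto simp: card_coset card_gt_0_iff)
  have "(\<Sum>y\<in>?A. chi n \<eta> y) = 0"
  proof (rule sum_eq_zero_by_involution[where \<phi> = "\<lambda>y. h + y"])
    show "h + y \<in> ?A" if "y \<in> ?A" for y
      using that h sub by (auto simp: Z2_subspace_iff add.assoc[symmetric])
    show "chi n \<eta> (h + y) = - chi n \<eta> y" for y
      using h by (simp add: chi_add) (simp add: chi_cases)
  qed simp
  then have "(\<Sum>y\<in>?A. f y * chi n \<eta> y) = (\<Sum>y\<in>?A. (f y - 1/2) * chi n \<eta> y)"
    by (simp add: left_diff_distrib sum_subtractf flip: sum_divide_distrib)
  also have "\<bar>\<dots>\<bar> \<le> (\<Sum>y\<in>?A. 1/2)"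
  proof (rule order_trans[OF sum_abs sum_mono])
    fix y assume "y \<in> ?A"
    then have "f y \<in> {0..1}" using f AG by blast
    then have "\<bar>f y - 1/2\<bar> \<le> 1/2" by (auto simp: abs_if)
    then show "\<bar>(f y - 1/2) * chi n \<eta> y\<bar> \<le> 1/2"
      by (simp add: abs_mult)
  qed
  finally show ?thesis
    using pos unfolding fourier_coeff_chi sum_constant by (simp only: abs_divide abs_of_pos pos_divide_le_eq mult.commute)
qed

section \<open>The layered function and its regular subspaces\<close>

lemma trunc_in_Z2vec [simp]: "trunc m x \<in> Z2vec m"
  by (simp add: trunc_def Z2vec_def)

lemma trunc_add_unit_vec: "m \<le> k \<Longrightarrow> trunc m (x + unit_vec k) = trunc m x"
  by (auto simp: trunc_def unit_vec_def fun_eq_iff)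

lemma chi_add_unit_vec:
  "k < n \<Longrightarrow> chi n \<eta> (x + unit_vec k) = (if \<eta> k = 0 then chi n \<eta> x else - chi n \<eta> x)"
  by (simp add: chi_add) (simp add: chi_cases Z2_inner_unit_vec)

text \<open>Block \<open>i\<close> occupies the coordinates from \<open>D i\<close> up to but
  excluding \<open>D (Suc i)\<close>. The block lengths stay abstract; tower growth enters only when
  the locale is instantiated.\<close>

locale spread_blocks =
  fixes n s :: nat and D :: "nat \<Rightarrow> nat" and \<xi> :: "nat \<Rightarrow> (nat \<Rightarrow> bit) \<Rightarrow> nat \<Rightarrow> bit"
  assumes D_0: "D 0 = 0" and D_mono: "mono D" and D_s: "D s = n" and s_pos: "0 < s"
    and spread_\<xi>: "\<And>i. i < s \<Longrightarrow> spread n (Z2vec (D i)) {D i..<D (Suc i)} (\<xi> i)"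
begin

definition layer :: "nat \<Rightarrow> (nat \<Rightarrow> bit) \<Rightarrow> real" where
  "layer i x = chi n (\<xi> i (trunc (D i) x)) x"

text \<open>Since \<open>(1 + layer i x) / 2\<close> is the indicator of orthogonality in layer
  \<open>i\<close>, this is the average of the \<open>s\<close> indicators.\<close>

definition f :: "(nat \<Rightarrow> bit) \<Rightarrow> real" where
  "f x = 1/2 + (\<Sum>i<s. layer i x) / (2 * real s)"

definition fibre :: "nat \<Rightarrow> (nat \<Rightarrow> bit) \<Rightarrow> (nat \<Rightarrow> bit) set" where
  "fibre i y = {x \<in> Z2vec n. trunc (D i) x = y}"

lemma \<xi>_in:
  "i < s \<Longrightarrow> y \<in> Z2vec (D i) \<Longrightarrow> \<xi> i y \<in> supported_on {D i..<D (Suc i)} - {0}"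
  using spread_nonzero[OF spread_\<xi>] .

lemma f_range: "f \<in> Z2vec n \<rightarrow> {0..1}"
proof
  fix x
  have "\<bar>\<Sum>i<s. layer i x\<bar> \<le> (\<Sum>i<s. 1)"
    by (rule order_trans[OF sum_abs sum_mono]) (simp add: layer_def)
  then have "\<bar>(\<Sum>i<s. layer i x) / (2 * real s)\<bar> \<le> 1/2"
    using s_pos by (simp add: abs_mult divide_simps)
  then show "f x \<in> {0..1}" unfolding f_def abs_le_iff by simp
qed

lemma D_le_n: "i \<le> s \<Longrightarrow> D i \<le> n"
  using D_mono D_s by (auto simp: mono_def)

lemma block_le_n: "i < s \<Longrightarrow> {D i..<D (Suc i)} \<subseteq> {..<n}"
  using D_le_n[of "Suc i"] by auto

lemma add_unit_vec_in_fibre: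
  assumes "D i \<le> k" "k < n" "x \<in> fibre i y"
  shows "x + unit_vec k \<in> fibre i y"
  using assms unit_vec_in_supported_on[of k "{..<n}"]
  by (auto simp: fibre_def trunc_add_unit_vec Z2vec_eq_supported_on intro: add_in_supported_on)

text \<open>Flip a coordinate of block \<open>i\<close> at which \<open>\<xi> i y\<close> is 1: this
  preserves the fibre and \<open>g\<close> but negates the character.\<close>

lemma sum_chi_fibre_eq_0:
  assumes i: "i < s" and y: "y \<in> Z2vec (D i)" 
    and inv: "\<And>x k. D i \<le> k \<Longrightarrow> k < n \<Longrightarrow> g (x + unit_vec k) = g x"
  shows "(\<Sum>x\<in>fibre i y. g x * chi n (\<xi> i y) x) = 0"
proof -
  obtain k where k: "k \<in> {D i..<D (Suc i)}" "\<xi> i y k = 1"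
    using \<xi>_in[OF i y] by (rule supported_on_nonzeroE)
  then have "D i \<le> k" "k < n" using block_le_n[OF i] by auto
  then show ?thesis
    using k by (intro sum_eq_zero_by_involution[where \<phi> = "\<lambda>x. x + unit_vec k"])
      (auto simp: add_unit_vec_in_fibre chi_add_unit_vec inv)
qed

text \<open>Flip a coordinate \<open>k x\<close> of block \<open>j\<close> in the support of the
  vector that layer \<open>j\<close> uses at \<open>x\<close>. That vector depends only on
  coordinates before block \<open>j\<close>, so \<open>k x\<close> survives the flip and the map is
  an involution. It negates layer \<open>j\<close> and fixes the character of
  \<open>\<xi> i y\<close>, which lives on block \<open>i\<close>.\<close>

lemma sum_later_layer_eq_0:
  assumes ij: "i < j" "j < s" and y: "y \<in> Z2vec (D i)" 
  shows "(\<Sum>x\<in>fibre i y. layer j x * chi n (\<xi> i y) x) = 0"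
proof -
  define k where "k x = (SOME k. \<xi> j (trunc (D j) x) k \<noteq> 0)" for x
  have k: "\<xi> j (trunc (D j) x) (k x) \<noteq> 0" for x
    unfolding k_def by (rule someI_ex) (use \<xi>_in[OF ij(2), of "trunc (D j) x"] in \<open>auto simp: fun_eq_iff\<close>)
  have kb: "k x \<in> {D j..<D (Suc j)}" for x
    using \<xi>_in[OF ij(2), of "trunc (D j) x"] k[of x] by (auto simp: supported_on_def)
  have kn: "k x < n" "D j \<le> k x" for x
    using kb[of x] block_le_n[OF ij(2)] by auto
  have Dij: "D (Suc i) \<le> D j" "D i \<le> D j" using D_mono ij by (auto simp: mono_def)
  have tr: "trunc (D j) (x + unit_vec (k x)) = trunc (D j) x" for x
    using kn by (simp add: trunc_add_unit_vec)
  then have kk: "k (x + unit_vec (k x)) = k x" for x by (simp add: k_def)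
  have "\<xi> i y (k x) = 0" for x
    using \<xi>_in[of i y] ij y Dij kn[of x] by (auto simp: supported_on_def)
  then show ?thesis
    using k kn Dij order_trans[OF Dij(2) kn(2)]
    by (intro sum_eq_zero_by_involution[where \<phi> = "\<lambda>x. x + unit_vec (k x)"])
      (auto simp: kk add_unit_vec_in_fibre layer_def tr chi_add_unit_vec)
qed

text \<open>The constant and the earlier layers ignore coordinates from \<open>D i\<close> on and
  cancel, as do the later layers. On the fibre, layer \<open>i\<close> is the character itself, so
  its product with it is 1.\<close>

lemma sum_f_chi_fibre:
  assumes i: "i < s" and y: "y \<in> Z2vec (D i)" 
  shows "(\<Sum>x\<in>fibre i y. f x * chi n (\<xi> i y) x) = real (card (fibre i y)) / (2 * real s)"
proof -
  let ?\<eta> = "\<xi> i y"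
  have layer: "(\<Sum>x\<in>fibre i y. layer j x * chi n ?\<eta> x) = (if j = i then real (card (fibre i y)) else 0)"
    if "j < s" for j
  proof (cases j i rule: linorder_cases)
    case less
    then have Dji: "D (Suc j) \<le> D i" "D j \<le> D i" using D_mono by (auto simp: mono_def)
    have "layer j (x + unit_vec k) = layer j x" if "D i \<le> k" "k < n" for x k
    proof -
      have "\<xi> j (trunc (D j) x) k = 0"
        using \<xi>_in[OF \<open>j < s\<close>, of "trunc (D j) x"] that Dji by (auto simp: supported_on_def)
      then show ?thesis
        using that Dji by (simp add: layer_def trunc_add_unit_vec chi_add_unit_vec)
    qed
    then show ?thesis
      using less sum_chi_fibre_eq_0[OF i y, of "layer j"] by simp
  next
    case equal
    then have "(\<Sum>x\<in>fibre i y. layer j x * chi n ?\<eta> x) = (\<Sum>x\<in>fibre i y. 1)"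
      by (intro sum.cong) (auto simp: layer_def fibre_def)
    then show ?thesis using equal by simp
  next
    case greater
    then show ?thesis using sum_later_layer_eq_0[OF _ that y] by auto
  qed
  have const: "(\<Sum>x\<in>fibre i y. 1/2 * chi n ?\<eta> x) = 0"
    by (rule sum_chi_fibre_eq_0[OF i y]) simp
  have "(\<Sum>x\<in>fibre i y. f x * chi n ?\<eta> x) =
    (\<Sum>x\<in>fibre i y. 1/2 * chi n ?\<eta> x + (\<Sum>j<s. layer j x * chi n ?\<eta> x) / (2 * real s))"
    by (intro sum.cong) (auto simp: f_def algebra_simps sum_distrib_left sum_divide_distrib)
  also have "\<dots> = (\<Sum>j<s. \<Sum>x\<in>fibre i y. layer j x * chi n ?\<eta> x) / (2 * real s)"
    unfolding sum.distrib const by (subst sum.swap) (simp add: sum_divide_distrib)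
  also have "\<dots> = (\<Sum>j<s. if j = i then real (card (fibre i y)) else 0) / (2 * real s)"
    by (intro arg_cong2[of _ _ _ _ "(/)"] sum.cong) (auto simp: layer)
  finally show ?thesis using i by simp
qed

lemma sum_card_fibre:
  assumes "i \<le> s" "Y \<subseteq> Z2vec (D i)"
  shows "card {x \<in> Z2vec n. trunc (D i) x \<in> Y \<and> P x} = (\<Sum>y\<in>Y. card {x \<in> fibre i y. P x})"
proof -
  have "{x \<in> Z2vec n. trunc (D i) x \<in> Y \<and> P x} = (\<Union>y\<in>Y. {x \<in> fibre i y. P x})"
    by (auto simp: fibre_def)
  moreover have "finite Y" using finite_subset[OF assms(2)] by simp
  ultimately show ?thesis
    by (simp only:) (rule card_UN_disjoint, auto simp: fibre_def)
qed

text \<open>Translation by \<open>y + z\<close> exchanges the fibres over \<open>y\<close> and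
  \<open>z\<close>, so all \<open>2 ^ D i\<close> of them have the same size.\<close>

lemma card_fibre:
  assumes i: "i \<le> s" and y: "y \<in> Z2vec (D i)"
  shows "2 ^ D i * card (fibre i y) = 2 ^ n"
proof -
  have tr: "trunc (D i) (x + y) = trunc (D i) x + y" if "y \<in> Z2vec (D i)" for x y
    using that by (auto simp: trunc_def Z2vec_def fun_eq_iff)
  have YG: "y \<in> Z2vec n" if "y \<in> Z2vec (D i)" for y
    using that D_le_n[OF i] by (auto simp: Z2vec_def)
  have eq: "card (fibre i z) = card (fibre i y)" if z: "z \<in> Z2vec (D i)" for z
  proof (rule bij_betw_same_card)
    have d: "y + z \<in> Z2vec (D i)"
      using y z by (simp add: Z2vec_def)
    have "x + (y + z) \<in> Z2vec n" if "x \<in> Z2vec n" for x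
      using that YG[OF d] by (simp add: Z2vec_def)
    moreover have "trunc (D i) (x + (y + z)) = trunc (D i) x + (y + z)" for x
      by (rule tr[OF d])
    moreover have "z + (y + z) = y" by (simp add: add.commute[of y z])
    ultimately show "bij_betw (\<lambda>x. x + (y + z)) (fibre i z) (fibre i y)"
      by (intro bij_betw_byWitness[where f' = "\<lambda>x. x + (y + z)"]) (simp_all add: fibre_def image_subset_iff)
  qed
  have "2 ^ n = (\<Sum>z\<in>Z2vec (D i). card (fibre i z))"
    using sum_card_fibre[OF i, of "Z2vec (D i)" "\<lambda>_. True"] by (simp add: card_Z2vec)
  then show ?thesis by (simp add: eq card_Z2vec)
qed

text \<open>As \<open>H\<close> vanishes before \<open>D i\<close>, its cosets stay inside the
  fibre. The vector \<open>h0\<close> shows that \<open>\<xi> i y\<close> is an admissible frequency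
  and gives the bound 1/2 on irregular cosets. With \<open>p\<close> the irregular proportion,
  \<open>8 * \<epsilon> \<le> \<epsilon> + p / 2\<close>.\<close>

lemma irregular_in_fibre_ge:
  assumes \<epsilon>: "16 * \<epsilon> * real s \<le> 1" "0 < \<epsilon>" and H: "Z2_linear_subspace n H"
    and i: "i < s" and vanish: "\<And>h k. h \<in> H \<Longrightarrow> k < D i \<Longrightarrow> h k = 0"
    and y: "y \<in> Z2vec (D i)" and h0: "h0 \<in> H" "Z2_inner n h0 (\<xi> i y) = 1"
  shows "14 * \<epsilon> * real (card (fibre i y)) \<le>
    real (card {x \<in> fibre i y. \<not> regular_on n \<epsilon> H (coset H x) f})"
proof -
  let ?\<eta> = "\<xi> i y" and ?B = "fibre i y"
  let ?I = "{x \<in> ?B. \<not> regular_on n \<epsilon> H (coset H x) f}"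
  have HG: "H \<subseteq> Z2vec n" using H by (auto simp: Z2_linear_subspace_def)
  then have finH: "finite H" by (rule finite_subset) simp
  have finB: "finite ?B" by (simp add: fibre_def)
  have "\<xi> i y \<in> Z2vec n"
    using \<xi>_in[OF i y] supported_on_mono[OF block_le_n[OF i]] by (auto simp: Z2vec_eq_supported_on)
  then have \<eta>: "?\<eta> \<in> Z2vec n - Z2_perp n H"
    using h0 by (auto simp: Z2_perp_def)
  have B_inv: "h + x \<in> ?B" if "x \<in> ?B" "h \<in> H" for x h
  proof -
    have "trunc (D i) (h + x) = trunc (D i) x"
      using vanish[OF that(2)] by (auto simp: trunc_def)
    then show ?thesis
      using that HG by (auto simp: fibre_def Z2vec_eq_supported_on intro: add_in_supported_on)
  qed
  have "8 * \<epsilon> * real (card ?B) \<le> real (card ?B) / (2 * real s)"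
    using mult_right_mono[OF \<epsilon>(1), of "real (card ?B)"] s_pos by (simp add: field_simps)
  also have "\<dots> = (\<Sum>x\<in>?B. fourier_coeff n (coset H x) f ?\<eta>)"
    using sum_f_chi_fibre[OF i y] sum_fourier_coeff_cosets[OF finH _ B_inv, of n f ?\<eta>] h0
    by (metis empty_iff)
  also have "\<dots> \<le> (\<Sum>x\<in>?B. \<epsilon> + (if \<not> regular_on n \<epsilon> H (coset H x) f then 1/2 else 0))"
  proof (rule sum_mono)
    fix x assume x: "x \<in> ?B"
    then have "\<bar>fourier_coeff n (coset H x) f ?\<eta>\<bar> \<le> 1/2"
      using abs_fourier_coeff_le_half[OF H f_range _ h0] by (simp add: fibre_def)
    then show "fourier_coeff n (coset H x) f ?\<eta> \<le>
        \<epsilon> + (if \<not> regular_on n \<epsilon> H (coset H x) f then 1/2 else 0)"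
      using \<eta> \<epsilon>(2) by (force simp: regular_on_def abs_le_iff)
  qed
  also have "\<dots> = \<epsilon> * real (card ?B) + real (card ?I) / 2"
    using finB by (simp add: sum.distrib flip: sum.inter_filter)
  finally show ?thesis by simp
qed

lemma regular_subspace_vanishes:
  assumes \<epsilon>: "16 * \<epsilon> * real s \<le> 1" "0 < \<epsilon>" and reg: "regular_subspace n \<epsilon> f H"
    and "i \<le> s" "h \<in> H" "k < D i"
  shows "h k = 0"
  using assms(4-)
proof (induction i arbitrary: h k)
  case 0
  then show ?case by (simp add: D_0)
next
  case (Suc i)
  have H: "Z2_linear_subspace n H" using reg by (simp add: regular_subspace_def)
  have i: "i < s" using Suc.prems by simp
  have vanish: "g k = 0" if "g \<in> H" "k < D i" for g k
    using Suc.IH[OF _ that] i by simp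
  show ?case
  proof (rule ccontr)
    assume hk: "h k \<noteq> 0"
    define Y where "Y = {y \<in> Z2vec (D i). Z2_inner n h (\<xi> i y) = 1}"
    have "D i \<le> k" using vanish[OF Suc.prems(2)] hk by (meson not_le_imp_less)
    then have spread: "2 ^ D i < 14 * card Y"
      using spread_card_gt[OF spread_\<xi>[OF i], of k h] Suc.prems hk by (simp add: Y_def card_Z2vec)
    let ?irr = "\<lambda>x. \<not> regular_on n \<epsilon> H (coset H x) f"
    have b: "real (card (fibre i y)) = 2 ^ n / 2 ^ D i" if "y \<in> Y" for y
      using arg_cong[OF card_fibre[of i y], of real] i that by (auto simp: Y_def field_simps)
    have "\<epsilon> * 2 ^ n < \<epsilon> * 2 ^ n * (14 * real (card Y) / 2 ^ D i)"
    proof -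
      have "2 ^ D i < 14 * real (card Y)"
        using spread by (metis (mono_tags, lifting) of_nat_less_iff of_nat_mult of_nat_numeral of_nat_power)
      then have "1 < 14 * real (card Y) / 2 ^ D i" by simp
      moreover have "0 < \<epsilon> * 2 ^ n" using \<epsilon> by simp
      ultimately show ?thesis by (metis mult.right_neutral mult_less_cancel_left_pos)
    qed
    also have "\<dots> = (\<Sum>y\<in>Y. 14 * \<epsilon> * real (card (fibre i y)))"
      by (simp add: b)
    also have "\<dots> \<le> (\<Sum>y\<in>Y. real (card {x \<in> fibre i y. ?irr x}))"
      using Suc.prems(2) vanish by (intro sum_mono irregular_in_fibre_ge[OF \<epsilon> H i, of _ h]) (auto simp: Y_def)
    also have "\<dots> = real (card {x \<in> Z2vec n. trunc (D i) x \<in> Y \<and> ?irr x})"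
      using sum_card_fibre[of i Y ?irr] i by (simp add: Y_def)
    also have "\<dots> \<le> real (card {x \<in> Z2vec n. ?irr x})"
      by (intro of_nat_mono card_mono) auto
    also have "\<dots> \<le> \<epsilon> * 2 ^ n" by (rule card_irregular_points_le[OF reg])
    finally show False by simp
  qed
qed

lemma regular_subspace_index:
  assumes "16 * \<epsilon> * real s \<le> 1" "0 < \<epsilon>" and reg: "regular_subspace n \<epsilon> f H"
  shows "subspace_index n H = 2 ^ n"
proof -
  have H: "Z2_linear_subspace n H" using reg by (simp add: regular_subspace_def)
  have "h = 0" if "h \<in> H" for h
  proof
    fix k
    show "h k = 0 k"
      using regular_subspace_vanishes[OF assms, of s h k] that H
      by (cases "k < n") (auto simp: D_s Z2_linear_subspace_def Z2vec_def)
  qed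
  moreover have "0 \<in> H" using H by (simp add: Z2_linear_subspace_def Z2_subspace_iff)
  ultimately have "card H = 1" by (metis card_1_singleton_iff is_singletonI' is_singleton_def One_nat_def empty_iff)
  then show ?thesis
    using card_points_eq_card_translates[OF H, of "\<lambda>_. True"]
    by (simp add: subspace_index_def card_Z2vec)
qed

end

section \<open>Tower growth of the block boundaries\<close>

definition block_length :: "nat \<Rightarrow> nat" where
  "block_length N = (if N < 14 then N else N div 2)"

fun block_start :: "nat \<Rightarrow> nat" where
  "block_start 0 = 0"
| "block_start (Suc i) = block_start i + block_length (2 ^ block_start i)"

lemma block_start_3: "block_start 3 = 11"
  by (simp add: numeral_3_eq_3 block_length_def)

lemma twr_pos: "0 < twr i"
  by (cases i) simp_all

text \<open>The surplus 2 pays for the halving in \<open>block_length\<close>: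
  \<open>2 ^ (t + 2) div 2\<close> is twice \<open>2 ^ t\<close>. The induction starts at index 3,
  from where \<open>2 ^ block_start\<close> exceeds 14 and the halving applies.\<close>

lemma block_start_ge: "twr (i + 2) + 2 \<le> block_start (i + 3)"
proof (induction i)
  case 0
  show ?case using block_start_3 by (simp add: numeral_2_eq_2)
next
  case (Suc i)
  have ge: "(2 :: nat) ^ (twr (i + 2) + 2) \<le> 2 ^ block_start (i + 3)"
    using Suc by (intro power_increasing) simp_all
  have "(2 :: nat) ^ 1 \<le> 2 ^ twr (i + 1)"
    using twr_pos[of "i + 1"] by (intro power_increasing) simp_all
  then have "4 \<le> block_start (i + 3)"
    using Suc by simp
  then have "(2 :: nat) ^ 4 \<le> 2 ^ block_start (i + 3)"
    by (intro power_increasing) simp_all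
  then have "block_length (2 ^ block_start (i + 3)) = 2 ^ block_start (i + 3) div 2"
    by (simp add: block_length_def)
  moreover have "block_start (Suc i + 3) = block_start (i + 3) + block_length (2 ^ block_start (i + 3))"
    by (simp only: add_Suc block_start.simps)
  moreover have "twr (Suc i + 2) = 2 ^ twr (i + 2)" by (simp only: add_Suc twr.simps)
  ultimately show ?case using ge Suc.IH by (simp only: power_add) simp
qed

text \<open>The shift by one costs nothing: the index will be
  \<open>2 ^ block_start (Suc i)\<close>, and this exponential supplies the last level of the
  tower.\<close>

lemma twr_le_block_start: "twr i \<le> block_start (Suc i)"
proof -
  consider "i = 0" | "i = 1" | j where "i = j + 2"
    by (metis One_nat_def Suc_1 add.commute add_2_eq_Suc not0_implies_Suc)
  then show ?thesis
  proof cases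
    case (3 j)
    then have "twr i + 2 \<le> block_start (Suc i)"
      using block_start_ge[of j] by (simp only: eval_nat_numeral add_Suc_right)
    then show ?thesis by simp
  qed (simp_all add: block_length_def)
qed

lemma mono_block_start: "mono block_start"
  by (simp add: mono_iff_le_Suc)

text \<open>The branches of \<open>block_length\<close> match the two constructions: unit vectors
  below 14, the weight argument with half as many coordinates from 14 on.\<close>

lemma ex_spread_assignment:
  assumes "block_start (Suc i) \<le> n"
  shows "\<exists>\<xi>. spread n (Z2vec (block_start i)) {block_start i..<block_start (Suc i)} \<xi>"
proof -
  let ?K = "{block_start i..<block_start (Suc i)}" and ?S = "Z2vec (block_start i)"
  have K: "?K \<subseteq> {..<n}" using assms by auto
  have cards: "card ?K = block_length (2 ^ block_start i)" "card ?S = 2 ^ block_start i"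
    by (simp_all add: card_Z2vec)
  show ?thesis
  proof (cases "card ?S < 14")
    case True
    then show ?thesis
      using cards by (intro ex_spread_assignment_small[OF K]) (simp_all add: block_length_def)
  next
    case False
    then have "card ?K > 0" "2 * card ?K \<le> card ?S"
      unfolding cards block_length_def by simp_all
    then show ?thesis
      by (intro ex_spread_assignment_half[OF K _ finite_Z2vec]) (auto simp only: card_gt_0_iff)
  qed
qed

section \<open>The lower bound for the regularity index\<close>

lemma ex_function_only_large_index:
  assumes s: "0 < s" and \<epsilon>: "16 * \<epsilon> * real s \<le> 1" "0 < \<epsilon>"
  shows "\<exists>n>0. \<exists>f \<in> Z2vec n \<rightarrow> {0..1}. \<forall>H. regular_subspace n \<epsilon> f H \<longrightarrow> twr s \<le> subspace_index n H"
proof -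
  define n where "n = block_start s"
  have "\<exists>\<xi>. spread n (Z2vec (block_start i)) {block_start i..<block_start (Suc i)} \<xi>" if "i < s" for i
    using that mono_block_start by (intro ex_spread_assignment) (simp only: n_def mono_def Suc_leI)
  then obtain \<xi> where
    "\<And>i. i < s \<Longrightarrow> spread n (Z2vec (block_start i)) {block_start i..<block_start (Suc i)} (\<xi> i)"
    by metis
  then interpret spread_blocks n s block_start \<xi>
    using s mono_block_start by unfold_locales (simp_all add: n_def)
  obtain t where t: "s = Suc t" using s by (cases s) auto
  have "0 < n" "twr s \<le> 2 ^ n"
    using twr_le_block_start[of t] twr_pos[of t] by (auto simp: n_def t simp del: block_start.simps)
  then show ?thesis
    using f_range regular_subspace_index[OF \<epsilon>] by (metis (no_types))
qed

theorem theorem2: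
  fixes \<epsilon> :: real
  assumes "\<epsilon> > 0"
  shows "regularity_M \<epsilon> \<ge> enat (twr (nat \<lfloor>1 / (16 * \<epsilon>)\<rfloor>)) \<and>
    (\<exists>n>0. \<exists>f \<in> Z2vec n \<rightarrow> {0..1}. \<forall>H. regular_subspace n \<epsilon> f H \<longrightarrow>
       subspace_index n H \<ge> twr (nat \<lfloor>1 / (16 * \<epsilon>)\<rfloor>))"
proof -
  define s where "s = nat \<lfloor>1 / (16 * \<epsilon>)\<rfloor>"
  have ex: "\<exists>n>0. \<exists>f \<in> Z2vec n \<rightarrow> {0..1}. \<forall>H. regular_subspace n \<epsilon> f H \<longrightarrow>
       twr s \<le> subspace_index n H"
  proof (cases "s = 0")
    \<comment> \<open>This is the range \<open>\<epsilon> > 1/16\<close>, where the claim is only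
      that an index is at least 1. Dimension 1 is taken because \<open>n\<close> must be
      positive.\<close>
    case True
    have "Z2vec 1 \<noteq> {}"
      using zero_in_supported_on unfolding Z2vec_eq_supported_on by blast
    then have "translates 1 H \<noteq> {}" "finite (translates 1 H)" for H
      by (simp_all add: translates_eq_image)
    then have "twr s \<le> subspace_index 1 H" for H
      using True by (simp add: subspace_index_def Suc_le_eq card_gt_0_iff)
    then show ?thesis
      by (intro exI[of _ 1] conjI bexI[of _ "\<lambda>_. 0"]) auto
  next
    case False
    have "real s \<le> 1 / (16 * \<epsilon>)"
      using assms by (simp add: s_def of_nat_nat)
    then have "16 * \<epsilon> * real s \<le> 1"
      using assms by (simp add: field_simps)
    then show ?thesis
      using ex_function_only_large_index[of s \<epsilon>] False assms by simp
  qed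
  then obtain n f where f: "f \<in> Z2vec n \<rightarrow> {0..1}"
    and large: "\<And>H. regular_subspace n \<epsilon> f H \<Longrightarrow> twr s \<le> subspace_index n H"
    by blast
  \<comment> \<open>A bound \<open>M\<close> must admit a regular subspace of index at most
    \<open>M\<close> for this particular \<open>f\<close>.\<close>
  have "twr s \<le> M" if "regularity_bound \<epsilon> M" for M
    using that f large unfolding regularity_bound_def by (meson order_trans)
  then have "enat (twr s) \<le> regularity_M \<epsilon>"
    unfolding regularity_M_def by (intro Inf_greatest) auto
  with ex show ?thesis unfolding s_def by blast
qed

end
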